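(* Let $k\ge 2$. (1) Let $W^1,\dots,W^4$ be simple $\mathrm{Vir}_{2k+1,2}$-modules and let $r=\mathrm{rank}\,\mathbb{V}_{0,4}(\mathrm{Vir}_{2k+1,2},W^\bullet)$. Then $$\deg\mathbb{V}_{0,4}(\mathrm{Vir}_{2k+1,2},W^\bullet)=-\frac{r(r-1)}{2}.$$ (2) For $0\le i\le k-1$, let $r=\mathrm{rank}\,\mathbb{V}_{1,1}(\mathrm{Vir}_{2k+1,2},W_{2i+1})$. Then $r=k-i$ and $$\deg\mathbb{V}_{1,1}(\mathrm{Vir}_{2k+1,2},W_{2i+1})=-r(r-1),$$ where degree on $\overline{\mathrm M}_{1,1}$ is normalized so that $\deg\lambda=1$; that is, $\mathbb{D}_{1,1}(\mathrm{Vir}_{2k+1,2},W_{2i+1})=-r(r-1)\lambda$.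
   Context: $\overline{\mathrm M}_{g,n}$ is the coarse moduli space of stable $n$-pointed genus $g$ curves; Picard groups have $\mathbb{Q}$-coefficients. On $\overline{\mathrm M}_{1,1}$ one has $\psi_1=\lambda$ and $\delta_{\mathrm{irr}}=12\lambda$. $\mathrm{Vir}_{2k+1,2}$ is the discrete series Virasoro VOA of central charge $c=-\frac{2(k-1)(6k-1)}{2k+1}$. Its simple modules are $W_1,\dots,W_{2k}$ with $W_i\simeq W_{2k+1-i}$ and no other isomorphisms; $W_1\simeq W_{2k}$ is the trivial module; all are self-dual; the conformal weight of $W_i$ is $h_i=-\frac{(2k-i)(i-1)}{2(2k+1)}$. Fusion rules: $W_{a}\boxtimes W_{b}=\sum_i W_i$ over $i\equiv |a-b|+1 \pmod 2$ with $|a-b|+1\le i\le \min(a+b,4k+2-a-b)-1$. $\mathbb{V}_{g,n}(V,W^\bullet)$ is the vector bundle of coinvariants for $V=\mathrm{Vir}_{2k+1,2}$ and $\mathbb{D}_{g,n}(V,W^\bullet)$ its first Chern class, whose degree is $\deg\mathbb{V}_{g,n}(V,W^\bullet)$. The rank in genus $0$ is the multiplicity of the trivial module in $W^1\boxtimes\cdots\boxtimes W^n$, and $\mathrm{rank}\,\mathbb{V}_{1,1}(V,M)=\sum_{W}\mathrm{rank}\,\mathbb{V}_{0,3}(V,M\otimes W\otimes W)$ over isomorphism classes of simple modules $W$. Explicitly, $\mathbb{D}_{0,4}(V,W^\bullet)=\mathrm{rank}\,\mathbb{V}_{0,4}\cdot\sum_i h_{W^i}\psi_i-\sum_{j=2}^4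 b_{\{1,j\}}\delta_{0,\{1,j\}}$ with $b_I=\sum_W h_W\,\mathrm{rank}\,\mathbb{V}_{0,3}(V,W^I\otimes W)\,\mathrm{rank}\,\mathbb{V}_{0,3}(V,W^{I^c}\otimes W)$, and $\mathbb{D}_{1,1}(V,M)=\mathrm{rank}\,\mathbb{V}_{1,1}(V,M)\big(\frac c2\lambda+h_M\psi_1\big)-\big(\sum_W h_W\,\mathrm{rank}\,\mathbb{V}_{0,3}(V,M\otimes W\otimes W)\big)\delta_{\mathrm{irr}}$. *)

theory Defs
  imports Complex_Main "HOL-Library.Multiset"
begin

section \<open>Simple modules of the discrete series Virasoro VOA $\mathrm{Vir}_{2k+1,2}$\<close>

text \<open>
  The labels \<open>1, \<dots>, 2k\<close> stand for the simple modules \<open>W\<^sub>1, \<dots>, W\<^sub>2\<^sub>k\<close>.  A simple module is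
  taken up to isomorphism, i.e. as a class of labels under \<open>i \<sim> 2k + 1 - i\<close>.
\<close>

type_synonym vir_module = "nat set"

definition label_iso :: "nat \<Rightarrow> (nat \<times> nat) set" where
  "label_iso k = {(i, j). i \<in> {1..2*k} \<and> j \<in> {1..2*k} \<and> (j = i \<or> j = 2*k + 1 - i)}"

definition simple_modules :: "nat \<Rightarrow> vir_module set" where
  "simple_modules k = {1..2*k} // label_iso k"

definition vir_W :: "nat \<Rightarrow> nat \<Rightarrow> vir_module" where
  "vir_W k i = label_iso k `` {i}"

abbreviation trivial_module :: "nat \<Rightarrow> vir_module" where
  "trivial_module k \<equiv> vir_W k 1"

definition central_charge :: "nat \<Rightarrow> rat" where
  "central_charge k = - (2 * (of_nat k - 1) * (6 * of_nat k - 1) / (2 * of_nat k + 1))"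

definition label_weight :: "nat \<Rightarrow> nat \<Rightarrow> rat" where
  "label_weight k i = - ((2 * of_nat k - of_nat i) * (of_nat i - 1) / (2 * (2 * of_nat k + 1)))"

text \<open>
  Notions on labels are passed to isomorphism classes with \<open>the_elem\<close>; the lemmas
  \<open>conf_weight_vir_W\<close> and \<open>fusion_vir_W\<close> below show independence of the representatives.
\<close>

definition conf_weight :: "nat \<Rightarrow> vir_module \<Rightarrow> rat" where
  "conf_weight k M = the_elem (label_weight k ` M)"

definition fusion_labels :: "nat \<Rightarrow> nat \<Rightarrow> nat \<Rightarrow> nat set" where
  "fusion_labels k a b =
     {i. int i mod 2 = (\<bar>int a - int b\<bar> + 1) mod 2 \<and>
         \<bar>int a - int b\<bar> + 1 \<le> int i \<and>
         int i \<le> min (int a + int b) (4 * int k + 2 - int a - int b) - 1}"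

definition label_fusion :: "nat \<Rightarrow> nat \<Rightarrow> nat \<Rightarrow> vir_module multiset" where
  "label_fusion k a b = image_mset (vir_W k) (mset_set (fusion_labels k a b))"

text \<open>A multiset of simple modules represents their direct sum.\<close>

definition fusion :: "nat \<Rightarrow> vir_module \<Rightarrow> vir_module \<Rightarrow> vir_module multiset" where
  "fusion k M N = the_elem ((\<lambda>(a, b). label_fusion k a b) ` (M \<times> N))"

text \<open>
  The fusion product of finitely many simple modules, by additivity of the fusion
  product in each argument; the empty product is the trivial module.
\<close>

fun fusion_prod :: "nat \<Rightarrow> vir_module list \<Rightarrow> vir_module multiset" where
  "fusion_prod k [] = {#trivial_module k#}"
| "fusion_prod k (M # Ms) = (\<Sum>N\<in>#fusion_prod k Ms. fusion k M N)"


section \<open>Ranks of the bundles of coinvariants\<close>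

definition rank0 :: "nat \<Rightarrow> vir_module list \<Rightarrow> nat" where
  "rank0 k Ms = count (fusion_prod k Ms) (trivial_module k)"

definition rank_0_4 :: "nat \<Rightarrow> (nat \<Rightarrow> vir_module) \<Rightarrow> nat" where
  "rank_0_4 k Ws = rank0 k [Ws 1, Ws 2, Ws 3, Ws 4]"

definition rank_1_1 :: "nat \<Rightarrow> vir_module \<Rightarrow> nat" where
  "rank_1_1 k M = (\<Sum>W\<in>simple_modules k. rank0 k [M, W, W])"


section \<open>Divisor classes on the moduli spaces of curves\<close>

text \<open>
  The moduli spaces enter through their rational Picard groups: a rational vector space
  containing the tautological classes, with a linear degree map having the standard
  values.  On $\overline{\mathrm M}_{0,4}\cong\mathbb P^1$ every \<open>\<psi>\<^sub>i\<close> and every boundary point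
  \<open>\<delta>\<^sub>0 {1, j}\<close> has degree 1.  On $\overline{\mathrm M}_{1,1}$ the degree is normalized so
  that \<open>\<lambda>\<close> has degree 1.
\<close>

locale pic_M_0_4 =
  vector_space scale
  for scale :: "rat \<Rightarrow> 'p::ab_group_add \<Rightarrow> 'p" +
  fixes \<psi> :: "nat \<Rightarrow> 'p"
    and \<delta>\<^sub>0 :: "nat set \<Rightarrow> 'p"
    and deg :: "'p \<Rightarrow> rat"
  assumes deg_linear: "Vector_Spaces.linear scale (*) deg"
    and deg_psi: "i \<in> {1..4} \<Longrightarrow> deg (\<psi> i) = 1"
    and deg_delta: "j \<in> {2..4} \<Longrightarrow> deg (\<delta>\<^sub>0 {1, j}) = 1"

locale pic_M_1_1 =
  vector_space scale
  for scale :: "rat \<Rightarrow> 'p::ab_group_add \<Rightarrow> 'p" +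
  fixes lam \<psi>\<^sub>1 \<delta>irr :: 'p
    and deg :: "'p \<Rightarrow> rat"
  assumes deg_linear: "Vector_Spaces.linear scale (*) deg"
    and psi_eq: "\<psi>\<^sub>1 = lam"
    and delta_irr_eq: "\<delta>irr = scale 12 lam"
    and deg_lambda: "deg lam = 1"


section \<open>First Chern classes of the bundles of coinvariants\<close>

text \<open>
  The bundles themselves are not constructed: their first Chern classes are given by the
  known expressions in tautological classes, and their ranks by the fusion rules
  (propagation and factorization).

  For \<open>I \<subseteq> {1..4}\<close>, \<open>sub_modules Ws I\<close> lists the modules \<open>W\<^sup>i\<close> at the points \<open>i \<in> I\<close>.
  No contragredients occur in \<open>b_coeff\<close> since all simple modules are self-dual.
\<close>

definition sub_modules :: "(nat \<Rightarrow> vir_module) \<Rightarrow> nat set \<Rightarrow> vir_module list" where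
  "sub_modules Ws I = map Ws (sorted_list_of_set I)"

definition b_coeff :: "nat \<Rightarrow> (nat \<Rightarrow> vir_module) \<Rightarrow> nat set \<Rightarrow> rat" where
  "b_coeff k Ws I =
     (\<Sum>W\<in>simple_modules k. conf_weight k W
        * of_nat (rank0 k (sub_modules Ws I @ [W]))
        * of_nat (rank0 k (sub_modules Ws ({1..4} - I) @ [W])))"

definition D_0_4 ::
  "(rat \<Rightarrow> 'p::ab_group_add \<Rightarrow> 'p) \<Rightarrow> (nat \<Rightarrow> 'p) \<Rightarrow> (nat set \<Rightarrow> 'p)
     \<Rightarrow> nat \<Rightarrow> (nat \<Rightarrow> vir_module) \<Rightarrow> 'p" where
  "D_0_4 scale \<psi> \<delta>\<^sub>0 k Ws =
     scale (of_nat (rank_0_4 k Ws)) (\<Sum>i=1..4. scale (conf_weight k (Ws i)) (\<psi> i))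
     - (\<Sum>j=2..4. scale (b_coeff k Ws {1, j}) (\<delta>\<^sub>0 {1, j}))"

definition D_1_1 ::
  "(rat \<Rightarrow> 'p::ab_group_add \<Rightarrow> 'p) \<Rightarrow> 'p \<Rightarrow> 'p \<Rightarrow> 'p \<Rightarrow> nat \<Rightarrow> vir_module \<Rightarrow> 'p" where
  "D_1_1 scale lam \<psi>\<^sub>1 \<delta>irr k M =
     scale (of_nat (rank_1_1 k M))
       (scale (central_charge k / 2) lam + scale (conf_weight k M) \<psi>\<^sub>1)
     - scale (\<Sum>W\<in>simple_modules k. conf_weight k W * of_nat (rank0 k [M, W, W])) \<delta>irr"


section \<open>Well-definedness and consistency\<close>

lemma equiv_label_iso: "equiv {1..2*k} (label_iso k)"
  by (rule equivI) (auto simp: label_iso_def refl_on_def sym_def trans_def)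

lemma vir_W_altdef: "i \<in> {1..2*k} \<Longrightarrow> vir_W k i = {i, 2*k + 1 - i}"
  by (auto simp: vir_W_def label_iso_def)

lemma vir_W_eq_iff:
  assumes "i \<in> {1..2*k}" "j \<in> {1..2*k}"
  shows "vir_W k i = vir_W k j \<longleftrightarrow> j = i \<or> j = 2*k + 1 - i"
  using eq_equiv_class_iff[OF equiv_label_iso assms] assms
  by (auto simp: vir_W_def label_iso_def)

lemma simple_modules_altdef: "simple_modules k = vir_W k ` {1..2*k}"
  by (auto simp: simple_modules_def vir_W_def quotient_def)

lemma label_weight_flip:
  assumes "i \<in> {1..2*k}"
  shows "label_weight k (2*k + 1 - i) = label_weight k i"
  using assms by (simp add: label_weight_def of_nat_diff algebra_simps)

lemma conf_weight_vir_W: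
  assumes "i \<in> {1..2*k}"
  shows "conf_weight k (vir_W k i) = label_weight k i"
proof -
  have "label_weight k ` vir_W k i = {label_weight k i}"
    using label_weight_flip[OF assms] by (simp add: vir_W_altdef[OF assms])
  then show ?thesis by (simp add: conf_weight_def)
qed

lemma fusion_labels_range: "fusion_labels k a b \<subseteq> {1..2*k}"
  by (auto simp: fusion_labels_def)

lemma fusion_labels_commute: "fusion_labels k a b = fusion_labels k b a"
proof -
  have "\<bar>int a - int b\<bar> = \<bar>int b - int a\<bar>" by (rule abs_minus_commute)
  moreover have "int a + int b = int b + int a" by (rule add.commute)
  moreover have "4 * int k + 2 - int a - int b = 4 * int k + 2 - int b - int a" by simp
  ultimately show ?thesis unfolding fusion_labels_def by (simp only:)
qed

lemma flip_in_fusion_labels: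
  assumes "b \<in> {1..2*k}" and "i \<in> fusion_labels k a b"
  shows "2*k + 1 - i \<in> fusion_labels k a (2*k + 1 - b)"
proof -
  have i: "1 \<le> i" "i \<le> 2*k" using assms(2) fusion_labels_range by fastforce+
  then have e: "int (2*k + 1 - i) = 2 * int k + 1 - int i"
      "int (2*k + 1 - b) = 2 * int k + 1 - int b"
    using assms(1) by auto
  have par: "(\<bar>z\<bar> + 1) mod 2 = (z + 1) mod 2" for z :: int by presburger
  have h: "int i mod 2 = (int a - int b + 1) mod 2" "\<bar>int a - int b\<bar> + 1 \<le> int i"
      "int i \<le> int a + int b - 1" "int i \<le> 4 * int k + 2 - int a - int b - 1"
    using assms(2) by (simp_all add: fusion_labels_def par)
  have "(2 * int k + 1 - int i) mod 2 = (int a - (2 * int k + 1 - int b) + 1) mod 2"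
    using h(1) by presburger
  moreover have "\<bar>int a - (2 * int k + 1 - int b)\<bar> + 1 \<le> 2 * int k + 1 - int i"
    using h(2-4) by linarith
  moreover have "2 * int k + 1 - int i \<le>
      min (int a + (2 * int k + 1 - int b)) (4 * int k + 2 - int a - (2 * int k + 1 - int b)) - 1"
    using h(2-4) by linarith
  ultimately show ?thesis unfolding fusion_labels_def mem_Collect_eq e par by blast
qed

lemma label_fusion_flip:
  assumes "b \<in> {1..2*k}"
  shows "label_fusion k a (2*k + 1 - b) = label_fusion k a b"
proof -
  let ?f = "\<lambda>i. 2*k + 1 - i"
  have inj: "inj_on ?f (fusion_labels k a b)"
    using fusion_labels_range[of k a b] by (intro inj_onI) fastforce
  have "fusion_labels k a (?f b) \<subseteq> ?f ` fusion_labels k a b"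
  proof
    fix i assume i: "i \<in> fusion_labels k a (?f b)"
    then have r: "i \<in> {1..2*k}" using fusion_labels_range by blast
    have "?f b \<in> {1..2*k}" "?f (?f b) = b" using assms by auto
    then have "?f i \<in> fusion_labels k a b" using flip_in_fusion_labels[OF _ i] by simp
    moreover have "i = ?f (?f i)" using r by auto
    ultimately show "i \<in> ?f ` fusion_labels k a b" by blast
  qed
  then have img: "fusion_labels k a (?f b) = ?f ` fusion_labels k a b"
    using flip_in_fusion_labels[OF assms] by blast
  have fin: "finite (fusion_labels k a b)"
    by (rule finite_subset[OF fusion_labels_range]) simp
  have W: "vir_W k (?f i) = vir_W k i" if "i \<in> fusion_labels k a b" for i
  proof -
    have "i \<in> {1..2*k}" using that fusion_labels_range by blast
    then show ?thesis by (subst vir_W_eq_iff) auto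
  qed
  have "label_fusion k a (?f b) =
      image_mset (vir_W k) (image_mset ?f (mset_set (fusion_labels k a b)))"
    by (simp only: label_fusion_def img image_mset_mset_set[OF inj])
  also have "\<dots> = label_fusion k a b"
    unfolding label_fusion_def multiset.map_comp
    using W fin by (intro image_mset_cong) simp
  finally show ?thesis .
qed

lemma fusion_vir_W:
  assumes a: "a \<in> {1..2*k}" and b: "b \<in> {1..2*k}"
  shows "fusion k (vir_W k a) (vir_W k b) =
           image_mset (vir_W k) (mset_set (fusion_labels k a b))"
proof -
  have comm: "label_fusion k x y = label_fusion k y x" for x y
    by (simp add: label_fusion_def fusion_labels_commute)
  have "label_fusion k x y = label_fusion k a b"
    if "x \<in> vir_W k a" "y \<in> vir_W k b" for x y
  proof -
    have "label_fusion k x y = label_fusion k x b"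
      using that(2) label_fusion_flip[OF b] by (auto simp: vir_W_altdef[OF b])
    also have "\<dots> = label_fusion k a b"
      using that(1) label_fusion_flip[OF a] comm by (auto simp: vir_W_altdef[OF a])
    finally show ?thesis .
  qed
  then have "(\<lambda>(x, y). label_fusion k x y) ` (vir_W k a \<times> vir_W k b) \<subseteq> {label_fusion k a b}"
    by (intro image_subsetI, elim SigmaE) (simp only: prod.case singleton_iff)
  moreover have "vir_W k a \<times> vir_W k b \<noteq> {}"
    using a b by (simp add: vir_W_altdef)
  ultimately have "(\<lambda>(x, y). label_fusion k x y) ` (vir_W k a \<times> vir_W k b) = {label_fusion k a b}"
    by (metis image_is_empty subset_singletonD)
  then show ?thesis by (simp add: fusion_def label_fusion_def)
qed

lemma pic_M_0_4_rat: "pic_M_0_4 ((*) :: rat \<Rightarrow> rat \<Rightarrow> rat) (\<lambda>_. 1) (\<lambda>_. 1) (\<lambda>x. x)"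
  by unfold_locales (auto simp: algebra_simps)

lemma pic_M_1_1_rat: "pic_M_1_1 ((*) :: rat \<Rightarrow> rat \<Rightarrow> rat) 1 1 12 (\<lambda>x. x)"
  by unfold_locales (auto simp: algebra_simps)

end

theory Submission
  imports Defs
begin

text \<open>
  Exactly one of the labels \<open>i\<close> and \<open>2k + 1 - i\<close> is odd, so the simple modules are indexed
  by \<^emph>\<open>spins\<close> \<open>0 \<le> x < k\<close>, the spin \<open>x\<close> standing for the label \<open>2x + 1\<close>.  In terms of spins
  the fusion rules become symmetric: the module of spin \<open>z\<close> occurs in the product of those of spins
  \<open>x\<close> and \<open>y\<close>, and then once, iff \<open>x, y, z\<close> satisfy the triangle inequalities and \<open>x + y + z < 2k\<close>; and the conformal weight
  is a quadratic polynomial \<open>x (2x + 1 - 2k)\<close> divided by \<open>2k + 1\<close>.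

  For four points of spins \<open>a, b, c, d\<close> the rank counts the intermediate spins \<open>z\<close> that are
  admissible both with \<open>a, b\<close> and with \<open>c, d\<close>, and the boundary coefficient is the sum of their
  weights.  These conditions are linear inequalities, so in each of the three channels (ways to
  split the points into pairs) the intermediate spins are consecutive, and all three
  intervals have the same length \<open>r\<close>, the rank.  A sum of the quadratic weight over \<open>r\<close> consecutive
  spins is \<open>r\<close> times a mean value (\<open>sum_spin_weight_interval\<close>), so the degree becomes \<open>r\<close> times a
  difference of polynomials.  If \<open>a \<ge> b \<ge> c \<ge> d\<close>, the three intervals start at
  \<open>a - b, a - c, a - d\<close> when \<open>a + d \<ge> b + c\<close>, and at \<open>c - d, b - d, a - d\<close> otherwise.  In each
  of the two cases \<open>r\<close> is the smaller of two linear forms (\<open>0\<close> if that is negative), and for either value the difference of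
  polynomials equals \<open>- (r - 1) (2k + 1) / 2\<close> (\<open>mean_identity_outer\<close>, \<open>mean_identity_inner\<close>).  The
  denominators cancel and \<open>- r (r - 1) / 2\<close> remains.  The formula is symmetric in the four points
  because a permutation of them permutes the channels, hence sorting loses nothing.

  In genus one, \<open>x\<close> contributes to the module of spin \<open>i\<close> iff \<open>i \<le> 2x < 2k - i\<close>.  These are
  \<open>k - i\<close> consecutive spins, and the same summation formula gives the degree
  (\<open>mean_identity_torus\<close>), the factor \<open>12\<close> coming from \<open>\<delta>\<^sub>i\<^sub>r\<^sub>r = 12 \<lambda>\<close>.
\<close>

section \<open>Simple modules indexed by spins\<close>

definition spin_module :: "nat \<Rightarrow> nat \<Rightarrow> vir_module" where
  "spin_module k x = vir_W k (2 * x + 1)"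

text \<open>
  The weight without its denominator \<open>2k + 1\<close>, over the rationals, so that the statements about
  weights reduce to polynomial identities.
\<close>
definition weight_numerator :: "rat \<Rightarrow> rat \<Rightarrow> rat" where
  "weight_numerator \<kappa> x = x * (2 * x + 1 - 2 * \<kappa>)"

definition spin_weight :: "nat \<Rightarrow> nat \<Rightarrow> rat" where
  "spin_weight k x = weight_numerator (of_nat k) (of_nat x) / (2 * of_nat k + 1)"

text \<open>
  The Clebsch-Gordan condition, truncated by \<open>x + y + z < 2k\<close>.  For odd labels, the parity
  condition in the fusion rules holds by itself.
\<close>
definition admissible :: "nat \<Rightarrow> nat \<Rightarrow> nat \<Rightarrow> nat \<Rightarrow> bool" where
  "admissible k x y z \<longleftrightarrow> x \<le> y + z \<and> y \<le> x + z \<and> z \<le> x + y \<and> x + y + z < 2 * k"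

lemma admissible_rotate: "admissible k x y z \<longleftrightarrow> admissible k y z x"
  by (auto simp: admissible_def)

lemma admissible_less: "admissible k x y z \<Longrightarrow> z < k"
  by (auto simp: admissible_def)

lemma admissible_zero: "x < k \<Longrightarrow> admissible k x 0 z \<longleftrightarrow> z = x"
  by (auto simp: admissible_def)

lemma finite_admissible [simp]: "finite {z. admissible k x y z}"
  by (rule finite_subset[of _ "{..<k}"]) (auto dest: admissible_less)

lemma inj_on_spin_module: "inj_on (spin_module k) {..<k}"
  by (rule inj_onI) (auto simp: spin_module_def vir_W_eq_iff, presburger)

text \<open>Since \<open>2k + 1\<close> is odd, an even label is paired with an odd one.\<close>
lemma simple_modules_spin: "simple_modules k = spin_module k ` {..<k}"
proof
  show "spin_module k ` {..<k} \<subseteq> simple_modules k"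
    by (auto simp: simple_modules_altdef spin_module_def)
  show "simple_modules k \<subseteq> spin_module k ` {..<k}"
  proof
    fix M assume "M \<in> simple_modules k"
    then obtain i where i: "i \<in> {1..2*k}" and M: "M = vir_W k i"
      by (auto simp: simple_modules_altdef)
    show "M \<in> spin_module k ` {..<k}"
    proof (cases "even i")
      case True
      then obtain m where m: "i = 2 * m" by (rule evenE)
      have "vir_W k i = vir_W k (2 * (k - m) + 1)"
        using i m by (subst vir_W_eq_iff) auto
      then have "M = spin_module k (k - m)" "k - m < k"
        using i M m by (auto simp: spin_module_def)
      then show ?thesis by blast
    next
      case False
      then obtain m where m: "i = 2 * m + 1" by (rule oddE)
      then have "M = spin_module k m" "m < k"
        using i M by (auto simp: spin_module_def)
      then show ?thesis by blast
    qed
  qed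
qed

lemma conf_weight_spin:
  assumes "x < k"
  shows "conf_weight k (spin_module k x) = spin_weight k x"
  using assms
  by (auto simp: spin_module_def spin_weight_def conf_weight_vir_W label_weight_def weight_numerator_def
      field_simps)

lemma fusion_labels_odd:
  assumes "x < k" "y < k"
  shows "fusion_labels k (2 * x + 1) (2 * y + 1) = (\<lambda>z. 2 * z + 1) ` {z. admissible k x y z}"
proof (rule set_eqI)
  fix i
  show "i \<in> fusion_labels k (2 * x + 1) (2 * y + 1)
      \<longleftrightarrow> i \<in> (\<lambda>z. 2 * z + 1) ` {z. admissible k x y z}"
  proof (cases "even i")
    case True
    have "(\<bar>int (2 * x + 1) - int (2 * y + 1)\<bar> + 1) mod 2 = 1" by presburger
    moreover have "int i mod 2 = 0" using True by presburger
    ultimately show ?thesis using True by (auto simp: fusion_labels_def)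
  next
    case False
    then obtain z where z: "i = 2 * z + 1" by (rule oddE)
    have "(\<bar>int (2 * x + 1) - int (2 * y + 1)\<bar> + 1) mod 2 = 1" by presburger
    moreover have "int i mod 2 = 1" using False by presburger
    ultimately have "i \<in> fusion_labels k (2 * x + 1) (2 * y + 1) \<longleftrightarrow> admissible k x y z"
      using assms unfolding fusion_labels_def admissible_def z by auto
    then show ?thesis by (auto simp: z)
  qed
qed

lemma fusion_spin:
  assumes "x < k" "y < k"
  shows "fusion k (spin_module k x) (spin_module k y) =
    image_mset (spin_module k) (mset_set {z. admissible k x y z})"
proof -
  have "mset_set (fusion_labels k (2 * x + 1) (2 * y + 1))
      = image_mset (\<lambda>z. 2 * z + 1) (mset_set {z. admissible k x y z})"
    unfolding fusion_labels_odd[OF assms] by (rule image_mset_mset_set[symmetric]) (simp add: inj_on_def)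
  then show ?thesis
    using assms fusion_vir_W[of "2 * x + 1" k "2 * y + 1"]
    by (simp add: spin_module_def[abs_def] multiset.map_comp comp_def)
qed

lemma count_fusion_spin:
  assumes "a < k" "x < k" "y < k"
  shows "count (fusion k (spin_module k x) (spin_module k y)) (spin_module k a)
    = of_bool (admissible k x y a)"
proof -
  have "spin_module k -` {spin_module k a} \<inter> {z. admissible k x y z}
      = (if admissible k x y a then {a} else {})"
  proof -
    have "z = a" if "spin_module k z = spin_module k a" "admissible k x y z" for z
      using inj_onD[OF inj_on_spin_module that(1)] admissible_less[OF that(2)] assms(1) by simp
    then show ?thesis by auto
  qed
  then show ?thesis
    using assms by (simp add: fusion_spin count_image_mset)
qed

lemma set_fusion_prod_subset:
  assumes "k > 0" "set Ms \<subseteq> simple_modules k"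
  shows "set_mset (fusion_prod k Ms) \<subseteq> simple_modules k"
  using assms(2)
proof (induction Ms)
  case Nil
  then show ?case using assms(1) by (auto simp: simple_modules_altdef)
next
  case (Cons M Ms)
  show ?case
  proof
    fix L assume "L \<in># fusion_prod k (M # Ms)"
    then obtain N where N: "N \<in># fusion_prod k Ms" "L \<in># fusion k M N" by auto
    then obtain x y where "x < k" "M = spin_module k x" "y < k" "N = spin_module k y"
      using Cons by (auto simp: simple_modules_spin)
    then show "L \<in> simple_modules k"
      using N(2) admissible_less[of k x y] by (auto simp: fusion_spin simple_modules_spin)
  qed
qed

section \<open>Genus zero ranks as counts of intermediate spins\<close>

lemma sum_mset_eq_sum_count:
  fixes f :: "'a \<Rightarrow> nat"
  assumes "finite A" "set_mset M \<subseteq> A"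
  shows "(\<Sum>x\<in>#M. f x) = (\<Sum>x\<in>A. count M x * f x)"
  using assms(2)
proof (induction M)
  case (add y M)
  have "(\<Sum>x\<in>A. count (add_mset y M) x * f x)
      = (\<Sum>x\<in>A. (if x = y then f x else 0) + count M x * f x)"
    by (intro sum.cong) auto
  then show ?case using add assms(1) by (simp add: sum.distrib)
qed simp

lemma count_sum_image_mset: "count (\<Sum>x\<in>#M. f x) a = (\<Sum>x\<in>#M. count (f x) a)"
  by (induction M) auto

text \<open>
  Associating the product to the right turns the multiplicity of a module into a sum over the
  intermediate module, that is, over the spins at the first node of a chain of three-pointed curves.
\<close>
lemma count_fusion_prod_Cons:
  assumes "a < k" "b < k" "set Ms \<subseteq> simple_modules k"
  shows "count (fusion_prod k (spin_module k b # Ms)) (spin_module k a)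
    = (\<Sum>z<k. count (fusion_prod k Ms) (spin_module k z) * of_bool (admissible k b z a))"
proof -
  let ?P = "fusion_prod k Ms"
  let ?f = "\<lambda>N. count (fusion k (spin_module k b) N) (spin_module k a)"
  have sub: "set_mset ?P \<subseteq> spin_module k ` {..<k}"
    using set_fusion_prod_subset[OF _ assms(3)] assms(1) by (simp add: simple_modules_spin)
  have "count (fusion_prod k (spin_module k b # Ms)) (spin_module k a) = (\<Sum>N\<in>#?P. ?f N)"
    by (simp add: count_sum_image_mset)
  also have "\<dots> = (\<Sum>N\<in>spin_module k ` {..<k}. count ?P N * ?f N)"
    using sub by (intro sum_mset_eq_sum_count) auto
  also have "\<dots> = (\<Sum>z<k. count ?P (spin_module k z) * ?f (spin_module k z))"
    by (simp add: sum.reindex[OF inj_on_spin_module])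
  also have "\<dots> = (\<Sum>z<k. count ?P (spin_module k z) * of_bool (admissible k b z a))"
    using assms by (intro sum.cong) (simp_all add: count_fusion_spin)
  finally show ?thesis .
qed

lemma trivial_module_spin: "trivial_module k = spin_module k 0"
  by (simp add: spin_module_def)

text \<open>
  Simple modules are self-dual: the product of two simple modules contains the trivial module,
  and then once, iff they are isomorphic.  So the rank is the multiplicity of the first module in
  the product of the others.
\<close>
lemma rank0_Cons:
  assumes "a < k" "set Ms \<subseteq> simple_modules k"
  shows "rank0 k (spin_module k a # Ms) = count (fusion_prod k Ms) (spin_module k a)"
proof -
  have "rank0 k (spin_module k a # Ms)
      = (\<Sum>z<k. count (fusion_prod k Ms) (spin_module k z) * of_bool (admissible k a z 0))"
    unfolding rank0_def trivial_module_spin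
    using assms by (intro count_fusion_prod_Cons) auto
  also have "\<dots> = (\<Sum>z<k. if z = a then count (fusion_prod k Ms) (spin_module k z) else 0)"
    using assms(1) by (intro sum.cong) (auto simp: admissible_def)
  finally show ?thesis using assms(1) by simp
qed

lemma count_fusion_prod_single:
  assumes "a < k" "c < k"
  shows "count (fusion_prod k [spin_module k c]) (spin_module k a) = of_bool (a = c)"
proof -
  have "fusion_prod k [spin_module k c] = fusion k (spin_module k c) (spin_module k 0)"
    by (simp add: spin_module_def)
  then show ?thesis using assms by (auto simp: count_fusion_spin admissible_zero)
qed

lemma count_fusion_prod_pair:
  assumes "a < k" "b < k" "c < k"
  shows "count (fusion_prod k [spin_module k b, spin_module k c]) (spin_module k a)
    = of_bool (admissible k b c a)"
proof -
  have "count (fusion_prod k [spin_module k b, spin_module k c]) (spin_module k a)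
      = (\<Sum>z<k. count (fusion_prod k [spin_module k c]) (spin_module k z)
          * of_bool (admissible k b z a))"
    using assms by (intro count_fusion_prod_Cons) (auto simp: simple_modules_spin)
  also have "\<dots> = (\<Sum>z<k. if z = c then of_bool (admissible k b z a) else 0)"
    by (intro sum.cong refl) (simp add: count_fusion_prod_single assms del: fusion_prod.simps)
  finally show ?thesis using assms by simp
qed

lemma rank0_three:
  assumes "a < k" "b < k" "c < k"
  shows "rank0 k [spin_module k a, spin_module k b, spin_module k c]
    = of_bool (admissible k a b c)"
proof -
  have "rank0 k [spin_module k a, spin_module k b, spin_module k c]
      = count (fusion_prod k [spin_module k b, spin_module k c]) (spin_module k a)"
    using assms by (intro rank0_Cons) (auto simp: simple_modules_spin)
  then show ?thesis
    by (simp only: count_fusion_prod_pair[OF assms] admissible_rotate[of k a b c])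
qed

text \<open>
  The modules that may sit at the node of the boundary curve separating the points \<open>a, b\<close> from
  \<open>c, d\<close>.
\<close>
definition channel :: "nat \<Rightarrow> nat \<Rightarrow> nat \<Rightarrow> nat \<Rightarrow> nat \<Rightarrow> nat set" where
  "channel k a b c d = {z. admissible k a b z \<and> admissible k c d z}"

lemma channel_subset: "channel k a b c d \<subseteq> {..<k}"
  by (auto simp: channel_def dest: admissible_less)

lemma channel_swap_left: "channel k a b c d = channel k b a c d"
  and channel_swap_right: "channel k a b c d = channel k a b d c"
  and channel_swap_pairs: "channel k a b c d = channel k c d a b"
  by (auto simp: channel_def admissible_def)

lemma rank0_four:
  assumes "a < k" "b < k" "c < k" "d < k"
  shows "rank0 k [spin_module k a, spin_module k b, spin_module k c, spin_module k d]
    = card (channel k a b c d)"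
proof -
  have "rank0 k [spin_module k a, spin_module k b, spin_module k c, spin_module k d]
      = count (fusion_prod k [spin_module k b, spin_module k c, spin_module k d]) (spin_module k a)"
    using assms by (intro rank0_Cons) (auto simp: simple_modules_spin)
  also have "\<dots> = (\<Sum>z<k. count (fusion_prod k [spin_module k c, spin_module k d])
      (spin_module k z) * of_bool (admissible k b z a))"
    using assms by (intro count_fusion_prod_Cons) (auto simp: simple_modules_spin)
  also have "\<dots> = (\<Sum>z<k. of_bool (admissible k c d z) * of_bool (admissible k b z a))"
    by (intro sum.cong refl) (simp add: count_fusion_prod_pair assms del: fusion_prod.simps)
  also have "\<dots> = (\<Sum>z<k. of_bool (z \<in> channel k a b c d))"
    by (intro sum.cong) (auto simp: channel_def admissible_def)
  also have "\<dots> = card (channel k a b c d)"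
    using channel_subset[of k a b c d] by (simp add: Int_absorb1 flip: Int_def)
  finally show ?thesis .
qed

section \<open>Sums of weights over consecutive spins\<close>

lemma two_k_plus_one_nonzero: "(2 * of_nat k + 1 :: rat) \<noteq> 0"
  by (metis of_nat_1 of_nat_add of_nat_eq_0_iff of_nat_mult of_nat_numeral add_is_0 one_neq_zero)

text \<open>The mean value of \<open>weight_numerator\<close> over the \<open>r\<close> arguments \<open>s, s + 1, \<dots>, s + r - 1\<close>.\<close>
definition interval_mean :: "rat \<Rightarrow> rat \<Rightarrow> rat \<Rightarrow> rat" where
  "interval_mean \<kappa> s r = 2 * s * s + 2 * s * (r - 1) + (r - 1) * (2 * r - 1) / 3
     - (2 * \<kappa> - 1) * (s + (r - 1) / 2)"

lemma sum_spin_weight_interval: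
  "(\<Sum>z\<in>{s..<s + r}. spin_weight k z) =
    of_nat r * interval_mean (of_nat k) (of_nat s) (of_nat r) / (2 * of_nat k + 1)"
proof (induction r)
  case (Suc r)
  have "(of_nat r :: rat) * interval_mean (of_nat k) (of_nat s) (of_nat r)
      + weight_numerator (of_nat k) (of_nat (s + r))
      = of_nat (Suc r) * interval_mean (of_nat k) (of_nat s) (of_nat (Suc r))"
    by (simp add: interval_mean_def weight_numerator_def field_simps)
  moreover have "spin_weight k (s + r) = weight_numerator (of_nat k) (of_nat (s + r)) / (2 * of_nat k + 1)"
    by (rule spin_weight_def)
  ultimately show ?case
    by (simp add: Suc.IH flip: add_divide_distrib)
qed simp

lemma cancel_denominator:
  fixes K :: rat
  assumes "K \<noteq> 0"
  shows "r * (- (x * K)) / K = - (r * x)"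
  using assms by simp

section \<open>The four-point identity\<close>

text \<open>
  The degree formula is bundled with the equality of the ranks computed in the three channels: in
  this form it is invariant under all permutations of the points, which only permute the channels.
\<close>
definition four_point_identity :: "nat \<Rightarrow> nat \<Rightarrow> nat \<Rightarrow> nat \<Rightarrow> nat \<Rightarrow> bool" where
  "four_point_identity k a b c d \<longleftrightarrow>
     (\<exists>r. card (channel k a b c d) = r \<and> card (channel k a c b d) = r \<and> card (channel k a d b c) = r
       \<and> of_nat r * (spin_weight k a + spin_weight k b + spin_weight k c + spin_weight k d)
          - sum (spin_weight k) (channel k a b c d) - sum (spin_weight k) (channel k a c b d)
          - sum (spin_weight k) (channel k a d b c) = - (of_nat r * (of_nat r - 1) / 2))"

text \<open>
  After division by the common factor \<open>r / (2k + 1)\<close> only the weights and the mean values over the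
  channels remain to be compared.
\<close>
lemma four_point_identity_intervals:
  assumes "channel k a b c d = {s..<s + r}" "channel k a c b d = {t..<t + r}"
    "channel k a d b c = {u..<u + r}"
  and mean: "r \<noteq> 0 \<Longrightarrow>
     weight_numerator (of_nat k) (of_nat a) + weight_numerator (of_nat k) (of_nat b)
     + weight_numerator (of_nat k) (of_nat c) + weight_numerator (of_nat k) (of_nat d)
     - interval_mean (of_nat k) (of_nat s) (of_nat r)
     - interval_mean (of_nat k) (of_nat t) (of_nat r)
     - interval_mean (of_nat k) (of_nat u) (of_nat r)
     = - ((of_nat r - 1) / 2 * (2 * of_nat k + 1))"
  shows "four_point_identity k a b c d"
proof -
  have "of_nat r * (spin_weight k a + spin_weight k b + spin_weight k c + spin_weight k d)
      - sum (spin_weight k) {s..<s + r} - sum (spin_weight k) {t..<t + r}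
      - sum (spin_weight k) {u..<u + r} = - (of_nat r * (of_nat r - 1) / 2)"
  proof (cases "r = 0")
    case False
    have "of_nat r * (spin_weight k a + spin_weight k b + spin_weight k c + spin_weight k d)
        - sum (spin_weight k) {s..<s + r} - sum (spin_weight k) {t..<t + r}
        - sum (spin_weight k) {u..<u + r}
      = of_nat r * (- ((of_nat r - 1) / 2 * (2 * of_nat k + 1))) / (2 * of_nat k + 1)"
      unfolding mean[OF False, symmetric] sum_spin_weight_interval spin_weight_def
      by (simp add: algebra_simps add_divide_distrib diff_divide_distrib)
    then show ?thesis by (simp only: cancel_denominator[OF two_k_plus_one_nonzero] times_divide_eq_right)
  qed simp
  then show ?thesis unfolding four_point_identity_def assms(1-3) by simp
qed

text \<open>
  Here the lower ends of the channels come from the largest spin \<open>a\<close>.  The first value of \<open>r\<close> occurs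
  when the triangle inequalities bound the channels from above, the second when the truncation of
  the fusion rules does.  The identity is symmetric in \<open>b, c, d\<close>.
\<close>
lemma mean_identity_outer:
  assumes "r = b + c + d + 1 - a \<or> r = 2 * \<kappa> - 2 * a"
  shows "weight_numerator \<kappa> a + weight_numerator \<kappa> b + weight_numerator \<kappa> c + weight_numerator \<kappa> d
    - interval_mean \<kappa> (a - b) r - interval_mean \<kappa> (a - c) r - interval_mean \<kappa> (a - d) r
    = - ((r - 1) / 2 * (2 * \<kappa> + 1))"
  using assms
  by (elim disjE; hypsubst; simp add: weight_numerator_def interval_mean_def field_simps)

text \<open>
  Here the lower ends of the channels \<open>ab|cd\<close> and \<open>ac|bd\<close>, like that of \<open>ad|bc\<close>, come from the
  smallest spin \<open>d\<close>; again the two values of \<open>r\<close> stem from the triangle inequalities and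
  from the truncation.
\<close>
lemma mean_identity_inner:
  assumes "r = 2 * d + 1 \<or> r = 2 * \<kappa> + d - a - b - c"
  shows "weight_numerator \<kappa> a + weight_numerator \<kappa> b + weight_numerator \<kappa> c + weight_numerator \<kappa> d
    - interval_mean \<kappa> (c - d) r - interval_mean \<kappa> (b - d) r - interval_mean \<kappa> (a - d) r
    = - ((r - 1) / 2 * (2 * \<kappa> + 1))"
  using assms
  by (elim disjE; hypsubst; simp add: weight_numerator_def interval_mean_def field_simps)

lemma four_point_identity_sorted:
  assumes "a < k" "b \<le> a" "c \<le> b" "d \<le> c"
  shows "four_point_identity k a b c d"
proof (cases "b + c \<le> a + d")
  case True
  \<comment> \<open>The upper bounds \<open>c + d\<close> and \<open>2k - 1 - a - b\<close> of the channel \<open>ab|cd\<close>, counted from its lower end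
    \<open>a - b\<close>.  Truncated subtraction gives \<open>r = 0\<close> when the channels are empty.\<close>
  define r where "r = min (b + c + d + 1 - a) (2 * k - 2 * a)"
  show ?thesis
  proof (rule four_point_identity_intervals[where r = r])
    show "channel k a b c d = {a - b..<a - b + r}" "channel k a c b d = {a - c..<a - c + r}"
      "channel k a d b c = {a - d..<a - d + r}"
      using assms True by (auto simp: channel_def admissible_def r_def)
    assume "r \<noteq> 0"
    then have "r + a = b + c + d + 1 \<or> r + 2 * a = 2 * k"
      unfolding r_def by linarith
    then have "(of_nat (r + a) :: rat) = of_nat (b + c + d + 1)
        \<or> (of_nat (r + 2 * a) :: rat) = of_nat (2 * k)"
      by metis
    then have r: "(of_nat r :: rat) = of_nat b + of_nat c + of_nat d + 1 - of_nat a
        \<or> (of_nat r :: rat) = 2 * of_nat k - 2 * of_nat a"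
      by (simp add: algebra_simps)
    show "weight_numerator (of_nat k) (of_nat a) + weight_numerator (of_nat k) (of_nat b)
        + weight_numerator (of_nat k) (of_nat c) + weight_numerator (of_nat k) (of_nat d)
        - interval_mean (of_nat k) (of_nat (a - b)) (of_nat r)
        - interval_mean (of_nat k) (of_nat (a - c)) (of_nat r)
        - interval_mean (of_nat k) (of_nat (a - d)) (of_nat r)
        = - ((of_nat r - 1) / 2 * (2 * of_nat k + 1))"
      using mean_identity_outer[OF r] assms by (simp add: of_nat_diff)
  qed
next
  case False
  \<comment> \<open>The same upper bounds, now counted from the lower end \<open>c - d\<close>.\<close>
  define r where "r = min (2 * d + 1) (2 * k + d - (a + b + c))"
  show ?thesis
  proof (rule four_point_identity_intervals[where r = r])
    show "channel k a b c d = {c - d..<c - d + r}" "channel k a c b d = {b - d..<b - d + r}"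
      "channel k a d b c = {a - d..<a - d + r}"
      using assms False by (auto simp: channel_def admissible_def r_def)
    assume "r \<noteq> 0"
    then have "r = 2 * d + 1 \<or> r + a + b + c = 2 * k + d"
      unfolding r_def by linarith
    then have "(of_nat r :: rat) = of_nat (2 * d + 1)
        \<or> (of_nat (r + a + b + c) :: rat) = of_nat (2 * k + d)"
      by metis
    then have r: "(of_nat r :: rat) = 2 * of_nat d + 1
        \<or> (of_nat r :: rat) = 2 * of_nat k + of_nat d - of_nat a - of_nat b - of_nat c"
      by (simp add: algebra_simps)
    show "weight_numerator (of_nat k) (of_nat a) + weight_numerator (of_nat k) (of_nat b)
        + weight_numerator (of_nat k) (of_nat c) + weight_numerator (of_nat k) (of_nat d)
        - interval_mean (of_nat k) (of_nat (c - d)) (of_nat r)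
        - interval_mean (of_nat k) (of_nat (b - d)) (of_nat r)
        - interval_mean (of_nat k) (of_nat (a - d)) (of_nat r)
        = - ((of_nat r - 1) / 2 * (2 * of_nat k + 1))"
      using mean_identity_inner[OF r] assms by (simp add: of_nat_diff)
  qed
qed

lemma four_point_identity_swap12:
  "four_point_identity k a b c d \<Longrightarrow> four_point_identity k b a c d"
  unfolding four_point_identity_def
  using channel_swap_left[of k a b c d] channel_swap_pairs[of k a c b d]
    channel_swap_pairs[of k a d b c]
  by (auto simp: algebra_simps)

lemma four_point_identity_swap23:
  "four_point_identity k a b c d \<Longrightarrow> four_point_identity k a c b d"
  unfolding four_point_identity_def
  using channel_swap_right[of k a d b c] by (auto simp: algebra_simps)

lemma four_point_identity_swap34:
  "four_point_identity k a b c d \<Longrightarrow> four_point_identity k a b d c"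
  unfolding four_point_identity_def
  using channel_swap_right[of k a b c d] by (auto simp: algebra_simps)

text \<open>
  Adjacent transpositions generate all permutations.  Membership in \<open>A\<close> carries the bound that the
  sorted case needs for its largest entry.
\<close>
lemma wlog_sorted_four:
  fixes P :: "'a::linorder \<Rightarrow> 'a \<Rightarrow> 'a \<Rightarrow> 'a \<Rightarrow> bool"
  assumes sorted: "\<And>a b c d. b \<le> a \<Longrightarrow> c \<le> b \<Longrightarrow> d \<le> c \<Longrightarrow> a \<in> A \<Longrightarrow> P a b c d"
    and 12: "\<And>a b c d. P a b c d \<Longrightarrow> P b a c d"
    and 23: "\<And>a b c d. P a b c d \<Longrightarrow> P a c b d"
    and 34: "\<And>a b c d. P a b c d \<Longrightarrow> P a b d c"
    and "a \<in> A" "b \<in> A" "c \<in> A" "d \<in> A"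
  shows "P a b c d"
proof -
  have s3: "P a b c d" if "c \<le> b" "d \<le> c" "a \<in> A" "b \<in> A" for a b c d
  proof -
    consider "b \<le> a" | "a \<le> b" "c \<le> a" | "a \<le> c" "d \<le> a" | "a \<le> d" by fastforce
    then show ?thesis
    proof cases
      case 1 then show ?thesis using that sorted by blast
    next
      case 2 then show ?thesis using that sorted 12 by blast
    next
      case 3 then show ?thesis using that sorted[of c b a d] 12 23 by blast
    next
      case 4 then show ?thesis using that sorted[of c b d a] 12 23 34 by blast
    qed
  qed
  have s2: "P a b c d" if "d \<le> c" "a \<in> A" "b \<in> A" "c \<in> A" for a b c d
  proof -
    consider "c \<le> b" | "b \<le> c" "d \<le> b" | "b \<le> d" by fastforce
    then show ?thesis
      using that s3[of c b d a] s3[of b c d a] s3[of d c b a] 23 34 by cases blast+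
  qed
  show ?thesis
    using assms(5-8) s2[of d c a b] s2[of c d a b] 34 linear[of d c] by blast
qed

lemma four_point_identity:
  assumes "a < k" "b < k" "c < k" "d < k"
  shows "four_point_identity k a b c d"
proof (rule wlog_sorted_four[where P = "four_point_identity k" and A = "{..<k}"])
  show "four_point_identity k a b c d" if "b \<le> a" "c \<le> b" "d \<le> c" "a \<in> {..<k}" for a b c d
    using that by (intro four_point_identity_sorted) simp_all
next
  show "four_point_identity k b a c d" if "four_point_identity k a b c d" for a b c d
    using that by (rule four_point_identity_swap12)
  show "four_point_identity k a c b d" if "four_point_identity k a b c d" for a b c d
    using that by (rule four_point_identity_swap23)
  show "four_point_identity k a b d c" if "four_point_identity k a b c d" for a b c d
    using that by (rule four_point_identity_swap34)
qed (use assms in simp_all)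

section \<open>Boundary sums and ranks in genus one\<close>

lemma sum_simple_modules:
  "(\<Sum>W\<in>simple_modules k. f W) = (\<Sum>x<k. f (spin_module k x))"
  by (simp add: simple_modules_spin sum.reindex[OF inj_on_spin_module])

lemma sum_weight_channel:
  assumes "a < k" "b < k" "c < k" "d < k"
  shows "(\<Sum>W\<in>simple_modules k. conf_weight k W
        * of_nat (rank0 k [spin_module k a, spin_module k b, W])
        * of_nat (rank0 k [spin_module k c, spin_module k d, W]))
    = sum (spin_weight k) (channel k a b c d)"
proof -
  have "sum (spin_weight k) (channel k a b c d)
      = (\<Sum>x<k. if x \<in> channel k a b c d then spin_weight k x else 0)"
    using channel_subset[of k a b c d]
    by (subst sum.inter_restrict[symmetric]) (auto simp: Int_absorb1)
  also have "\<dots> = (\<Sum>x<k. conf_weight k (spin_module k x)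
        * of_nat (rank0 k [spin_module k a, spin_module k b, spin_module k x])
        * of_nat (rank0 k [spin_module k c, spin_module k d, spin_module k x]))"
    by (intro sum.cong refl) (simp add: assms conf_weight_spin rank0_three channel_def)
  finally show ?thesis by (simp only: sum_simple_modules)
qed

text \<open>
  The spins \<open>x\<close> with \<open>admissible k i x x\<close> are those with \<open>i \<le> 2x < 2k - i\<close>.  They start
  at \<open>i / 2\<close> rounded up, and their number is \<open>k - i\<close> for either parity of \<open>i\<close> because the two
  bounds \<open>i\<close> and \<open>2k - i\<close> have the same parity.
\<close>
lemma rank_1_1_spin:
  assumes "i < k"
  shows "rank_1_1 k (spin_module k i) = k - i"
    and "(\<Sum>W\<in>simple_modules k. conf_weight k W * of_nat (rank0 k [spin_module k i, W, W]))
      = sum (spin_weight k) {(i + 1) div 2..<(i + 1) div 2 + (k - i)}"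
proof -
  have S: "{x. x < k \<and> admissible k i x x} = {(i + 1) div 2..<(i + 1) div 2 + (k - i)}"
    using assms by (auto simp: admissible_def)
  have "rank_1_1 k (spin_module k i) = (\<Sum>x<k. of_bool (admissible k i x x))"
    using assms unfolding rank_1_1_def sum_simple_modules by (simp add: rank0_three)
  also have "\<dots> = card {x. x < k \<and> admissible k i x x}"
    by (simp add: Int_def)
  finally show "rank_1_1 k (spin_module k i) = k - i" by (simp add: S)
  show "(\<Sum>W\<in>simple_modules k. conf_weight k W * of_nat (rank0 k [spin_module k i, W, W]))
      = sum (spin_weight k) {(i + 1) div 2..<(i + 1) div 2 + (k - i)}"
  proof -
    have "sum (spin_weight k) {x. x < k \<and> admissible k i x x}
        = (\<Sum>x<k. if admissible k i x x then spin_weight k x else 0)"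
      by (subst sum.inter_filter[symmetric]) simp_all
    also have "\<dots> = (\<Sum>x<k. conf_weight k (spin_module k x)
        * of_nat (rank0 k [spin_module k i, spin_module k x, spin_module k x]))"
      by (intro sum.cong refl) (simp add: assms conf_weight_spin rank0_three)
    finally show ?thesis by (simp only: sum_simple_modules S)
  qed
qed

text \<open>
  The summands are the numerators of \<open>c / 2\<close>, of the weight at the marked point, and of \<open>12\<close> times
  the mean weight at the node, where the interval of length \<open>\<kappa> - x\<close> starts at \<open>s\<close>.
\<close>
lemma mean_identity_torus:
  assumes "2 * s = x \<or> 2 * s = x + 1"
  shows "- ((\<kappa> - 1) * (6 * \<kappa> - 1)) + weight_numerator \<kappa> x - 12 * interval_mean \<kappa> s (\<kappa> - x)
    = - ((\<kappa> - x - 1) * (2 * \<kappa> + 1))"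
proof -
  have "x = 2 * s \<or> x = 2 * s - 1" using assms by auto
  then show ?thesis
    by (elim disjE; hypsubst; simp add: weight_numerator_def interval_mean_def field_simps)
qed

lemma torus_identity:
  assumes "i < k"
  shows "of_nat (k - i) * (central_charge k / 2 + spin_weight k i)
    - 12 * sum (spin_weight k) {(i + 1) div 2..<(i + 1) div 2 + (k - i)}
    = - (of_nat (k - i) * (of_nat (k - i) - 1))"
proof -
  define s where "s = (i + 1) div 2"
  have r: "(of_nat (k - i) :: rat) = of_nat k - of_nat i" using assms by (simp add: of_nat_diff)
  have c: "central_charge k / 2 = - ((of_nat k - 1) * (6 * of_nat k - 1)) / (2 * of_nat k + 1)"
  proof -
    have "- (2 * x * y / K) / 2 = - (x * y) / K" for x y K :: rat by simp
    then show ?thesis unfolding central_charge_def .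
  qed
  have "2 * s = i \<or> 2 * s = i + 1" unfolding s_def by presburger
  then have "of_nat (2 * s) = (of_nat i :: rat) \<or> of_nat (2 * s) = (of_nat (i + 1) :: rat)" by metis
  then have s: "2 * of_nat s = (of_nat i :: rat) \<or> 2 * of_nat s = (of_nat i + 1 :: rat)"
    by (simp add: add.commute)
  have common_denominator:
    "n * (A / K + B / K) - 12 * (n * C / K) = n * (A + B - 12 * C) / K" for n A B C K :: rat
    by (simp add: algebra_simps add_divide_distrib diff_divide_distrib)
  have "of_nat (k - i) * (central_charge k / 2 + spin_weight k i)
      - 12 * sum (spin_weight k) {s..<s + (k - i)}
    = of_nat (k - i) * (- ((of_nat (k - i) - 1) * (2 * of_nat k + 1))) / (2 * of_nat k + 1)"
    by (simp only: c spin_weight_def sum_spin_weight_interval common_denominator r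
        mean_identity_torus[OF s])
  then show ?thesis by (simp only: cancel_denominator[OF two_k_plus_one_nonzero] s_def)
qed

section \<open>Degrees of the divisor classes\<close>

lemma deg_D_0_4:
  assumes "pic_M_0_4 scale \<psi> \<delta>\<^sub>0 deg" and "\<forall>i\<in>{1..4}. Ws i \<in> simple_modules k"
  shows "deg (D_0_4 scale \<psi> \<delta>\<^sub>0 k Ws)
    = - (of_nat (rank_0_4 k Ws) * (of_nat (rank_0_4 k Ws) - 1) / 2)"
proof -
  interpret pic_M_0_4 scale \<psi> \<delta>\<^sub>0 deg by (rule assms(1))
  interpret L: Vector_Spaces.linear scale "(*)" deg by (rule deg_linear)
  have "\<forall>i\<in>{1..4}. \<exists>x<k. Ws i = spin_module k x"
    using assms(2) by (auto simp: simple_modules_spin)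
  then obtain x where x: "\<And>i. i \<in> {1..4} \<Longrightarrow> x i < k \<and> Ws i = spin_module k (x i)"
    by metis
  have W: "Ws 1 = spin_module k (x 1)" "Ws 2 = spin_module k (x 2)"
      "Ws 3 = spin_module k (x 3)" "Ws 4 = spin_module k (x 4)"
    and lt: "x 1 < k" "x 2 < k" "x 3 < k" "x 4 < k"
    using x by auto
  have ivl: "{1..4::nat} = {1, 2, 3, 4}" "{2..4::nat} = {2, 3, 4}" by auto
  have compl: "{1, 2, 3, 4} - {1, 2} = {3, 4::nat}" "{1, 2, 3, 4} - {1, 3} = {2, 4::nat}"
      "{1, 2, 3, 4} - {1, 4} = {2, 3::nat}"
    by auto
  have b: "b_coeff k Ws {1, 2} = sum (spin_weight k) (channel k (x 1) (x 2) (x 3) (x 4))"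
      "b_coeff k Ws {1, 3} = sum (spin_weight k) (channel k (x 1) (x 3) (x 2) (x 4))"
      "b_coeff k Ws {1, 4} = sum (spin_weight k) (channel k (x 1) (x 4) (x 2) (x 3))"
    using lt unfolding b_coeff_def ivl compl sub_modules_def
    by (simp_all add: W W(1)[unfolded One_nat_def] sum_weight_channel)
  have h: "conf_weight k (Ws i) = spin_weight k (x i)" if "i \<in> {1, 2, 3, 4}" for i
    using x[of i] that conf_weight_spin by auto
  have rk: "rank_0_4 k Ws = card (channel k (x 1) (x 2) (x 3) (x 4))"
    unfolding rank_0_4_def W using lt by (rule rank0_four)
  have psi: "deg (\<psi> i) = 1" if "i \<in> {1, 2, 3, 4}" for i using deg_psi that by auto
  have delta: "deg (\<delta>\<^sub>0 {1, j}) = 1" if "j \<in> {2, 3, 4}" for j using deg_delta that by auto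
  have "deg (D_0_4 scale \<psi> \<delta>\<^sub>0 k Ws) =
      of_nat (rank_0_4 k Ws) * (\<Sum>i\<in>{1, 2, 3, 4}. conf_weight k (Ws i) * deg (\<psi> i))
      - (\<Sum>j\<in>{2, 3, 4}. b_coeff k Ws {1, j} * deg (\<delta>\<^sub>0 {1, j}))"
    unfolding D_0_4_def ivl L.diff L.scale L.sum ..
  also have "\<dots> = of_nat (rank_0_4 k Ws) * (\<Sum>i\<in>{1, 2, 3, 4}. spin_weight k (x i))
      - (\<Sum>j\<in>{2, 3, 4}. b_coeff k Ws {1, j})"
    using h psi delta by (intro arg_cong2[where f = minus] arg_cong2[where f = times] sum.cong) auto
  also have "\<dots> = - (of_nat (rank_0_4 k Ws) * (of_nat (rank_0_4 k Ws) - 1) / 2)"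
    using four_point_identity[OF lt] b
    unfolding four_point_identity_def rk by (auto simp: algebra_simps)
  finally show ?thesis .
qed

lemma D_1_1_spin:
  assumes "pic_M_1_1 scale lam \<psi>\<^sub>1 \<delta>irr deg" and "i < k"
  shows "D_1_1 scale lam \<psi>\<^sub>1 \<delta>irr k (spin_module k i)
    = scale (- (of_nat (k - i) * (of_nat (k - i) - 1))) lam"
proof -
  interpret pic_M_1_1 scale lam \<psi>\<^sub>1 \<delta>irr deg by (rule assms(1))
  show ?thesis
    unfolding D_1_1_def psi_eq delta_irr_eq rank_1_1_spin[OF assms(2)] conf_weight_spin[OF assms(2)]
      torus_identity[OF assms(2), symmetric]
    by (simp add: scale_left_distrib scale_left_diff_distrib scale_right_distrib algebra_simps)
qed

theorem theorem3p3:
  fixes k :: nat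
    and scale4 :: "rat \<Rightarrow> 'p::ab_group_add \<Rightarrow> 'p"
    and \<psi> :: "nat \<Rightarrow> 'p" and \<delta>\<^sub>0 :: "nat set \<Rightarrow> 'p" and deg4 :: "'p \<Rightarrow> rat"
    and scale1 :: "rat \<Rightarrow> 'q::ab_group_add \<Rightarrow> 'q"
    and lam \<psi>\<^sub>1 \<delta>irr :: 'q and deg1 :: "'q \<Rightarrow> rat"
  assumes "k \<ge> 2"
    and "pic_M_0_4 scale4 \<psi> \<delta>\<^sub>0 deg4"
    and "pic_M_1_1 scale1 lam \<psi>\<^sub>1 \<delta>irr deg1"
  shows "(\<forall>Ws :: nat \<Rightarrow> vir_module. (\<forall>i\<in>{1..4}. Ws i \<in> simple_modules k) \<longrightarrow>
            (let r = (of_nat (rank_0_4 k Ws) :: rat)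
             in deg4 (D_0_4 scale4 \<psi> \<delta>\<^sub>0 k Ws) = - (r * (r - 1) / 2)))
       \<and> (\<forall>i\<in>{0..k - 1}.
            rank_1_1 k (vir_W k (2*i + 1)) = k - i \<and>
            (let r = (of_nat (rank_1_1 k (vir_W k (2*i + 1))) :: rat);
                 D = D_1_1 scale1 lam \<psi>\<^sub>1 \<delta>irr k (vir_W k (2*i + 1))
             in deg1 D = - (r * (r - 1)) \<and> D = scale1 (- (r * (r - 1))) lam))"
proof (intro conjI allI impI ballI)
  fix Ws :: "nat \<Rightarrow> vir_module"
  assume "\<forall>i\<in>{1..4}. Ws i \<in> simple_modules k"
  then show "let r = (of_nat (rank_0_4 k Ws) :: rat)
      in deg4 (D_0_4 scale4 \<psi> \<delta>\<^sub>0 k Ws) = - (r * (r - 1) / 2)"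
    unfolding Let_def by (rule deg_D_0_4[OF assms(2)])
next
  fix i assume "i \<in> {0..k - 1}"
  then have i: "i < k" using assms(1) by auto
  show "rank_1_1 k (vir_W k (2*i + 1)) = k - i"
    using rank_1_1_spin(1)[OF i] by (simp add: spin_module_def)
  interpret pic_M_1_1 scale1 lam \<psi>\<^sub>1 \<delta>irr deg1 by (rule assms(3))
  interpret L: Vector_Spaces.linear scale1 "(*)" deg1 by (rule deg_linear)
  show "let r = (of_nat (rank_1_1 k (vir_W k (2*i + 1))) :: rat);
            D = D_1_1 scale1 lam \<psi>\<^sub>1 \<delta>irr k (vir_W k (2*i + 1))
        in deg1 D = - (r * (r - 1)) \<and> D = scale1 (- (r * (r - 1))) lam"
    unfolding Let_def spin_module_def[symmetric] D_1_1_spin[OF assms(3) i] rank_1_1_spin(1)[OF i]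
    by (simp add: L.scale deg_lambda del: scale_minus_left)
qed

end
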